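(* Let $x^*$ be an optimal solution to the quadratically constrained quadratic program $$\min_{x\in\mathbb{R}^{2n}}\ g(x)=\|x-\widehat x\|^2\quad\text{s.t.}\quad f_{ij}(x)=0,\ 1\le i<j\le n.$$ The triangulation problem (given by the cameras $P_1,\dots,P_n$ and observations $\widehat x$) is SDP-EXACT if and only if there exist $\lambda_{ij}\in\mathbb{R}$ ($1\le i<j\le n$) such that $$\text{(i)}\ \ \nabla g(x^* )+\sum_{i<j}\lambda_{ij}\nabla f_{ij}(x^* )=0\qquad\text{and}\qquad\text{(ii)}\ \ I+\sum_{i<j}\lambda_{ij}H_{ij}\succeq0 .$$
   Context: Let $n\ge 2$ and let $P_1,\dots,P_n\in\mathbb{R}^{3\times 4}$ be projective cameras (rank $3$ matrices) with pairwise distinct centers (the center of $P_i$ is its one-dimensional kernel viewed as a point of projective $3$-space). Let $\widehat x\in\mathbb{R}^{2n}$ be a vector of image observations. For a vector $y$, $\tilde y=[y;1]$ (append a last entry $1$). $\mathcal{S}^k$ is the space of real symmetric $k\times k$ matrices with inner product $\langle A,B\rangle=\sum_{i,j}A_{ij}B_{ij}$, and $\mathcal{S}^k_+$ is the cone of positive semidefinite ones. Write $x=[x_1;\dots;x_n]\in\mathbb{R}^{2n}$ with $x_i\in\mathbb{R}^2$. For $i<j$ let $f_{ij}(x)=\tilde x_i^\top\Phi_{ij}\tilde x_j$, where $\Phi_{ij}\in\mathbb{R}^{3\times3}$ is the fundamental matrix of cameras $i,j$, i.e. up to a (fixed) nonzero scalar the rank-2 matrix given by $\tilde x_i^\top \Phi_{ij}\tilde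 x_j=\det\begin{bmatrix}P_i&\tilde x_i&0 \\ P_j&0&\tilde x_j\end{bmatrix}$. Let $F_{ij}\in\mathcal{S}^{2n+1}$ be the symmetric matrix with $f_{ij}(x)=\tilde x^\top F_{ij}\tilde x$, and write $F_{ij}=\begin{bmatrix}H_{ij}&b_{ij} \\ {b_{ij}^\top}&\beta_{ij}\end{bmatrix}$ with $H_{ij}\in\mathcal{S}^{2n}$, $b_{ij}\in\mathbb{R}^{2n}$, $\beta_{ij}\in\mathbb{R}$. Let $g(x)=\|x-\widehat x\|^2=\tilde x^\top G\tilde x$ with $G=\begin{bmatrix}I&-\widehat x \\ -\widehat x^\top&\|\widehat x\|^2\end{bmatrix}$, and let $E\in\mathcal{S}^{2n+1}$ be zero except for its bottom right entry, which is $1$. Define the optimal values: - $g^{\rm quad}$: minimum of $g(x)$ subject to $f_{ij}(x)=0$ for all $1\le i<j\le n$, $x\in\mathbb{R}^{2n}$; - $g^{\rm mom}$ (primal SDP): minimum of $\langle G,Y\rangle$ subject to $\langle F_{ij},Y\rangle=0$ for all $i<j$, $\langle E,Y\rangle=1$, $Y\in\mathcal{S}^{2n+1}_+$; - $g^{\rm sos}$ (dual SDP): maximum of $\rho$ subject to $G+\sum_{i<j}\lambda_{ij}F_{ij}-\rho E\succeq0$, $\lambda_{ij},\rho\in\mathbb{R}$. The triangulation problem is called SDP-EXACT if $g^{\rm quad}=g^{\rm sos}=g^{\rm mom}$. *)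

theory Defs
  imports "HOL-Analysis.Analysis"
begin

section \<open>Cameras and fundamental matrices\<close>

definition homog2 :: "real^2 \<Rightarrow> real^3" where
  "homog2 y = vector [y$1, y$2, 1]"

text \<open>The center of a camera is a point of projective space, i.e. a line through the origin
  of \<open>\<real>\<^sup>4\<close>; it is represented by that line.\<close>

definition camera_center :: "real^4^3 \<Rightarrow> (real^4) set" where
  "camera_center P = {v. P *v v = 0}"

definition two_view_matrix :: "real^4^3 \<Rightarrow> real^4^3 \<Rightarrow> real^3 \<Rightarrow> real^3 \<Rightarrow> real^6^6" where
  "two_view_matrix P Q u v = vector
     [vector [P$1$1, P$1$2, P$1$3, P$1$4, u$1, 0],
      vector [P$2$1, P$2$2, P$2$3, P$2$4, u$2, 0],
      vector [P$3$1, P$3$2, P$3$3, P$3$4, u$3, 0],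
      vector [Q$1$1, Q$1$2, Q$1$3, Q$1$4, 0, v$1],
      vector [Q$2$1, Q$2$2, Q$2$3, Q$2$4, 0, v$2],
      vector [Q$3$1, Q$3$2, Q$3$3, Q$3$4, 0, v$3]]"

text \<open>The fundamental matrix is determined by the two cameras only up to a nonzero scalar, hence a
  predicate.\<close>

definition fundamental_matrix :: "real^4^3 \<Rightarrow> real^4^3 \<Rightarrow> real^3^3 \<Rightarrow> bool" where
  "fundamental_matrix P Q \<Phi> \<longleftrightarrow>
     (\<exists>c. c \<noteq> 0 \<and> (\<forall>y z. homog2 y \<bullet> (\<Phi> *v homog2 z)
                         = c * det (two_view_matrix P Q (homog2 y) (homog2 z))))"


section \<open>Homogenization, block matrices, semidefiniteness\<close>

text \<open>If \<open>'m\<close> has \<open>k\<close> elements, then \<^typ>\<open>'m + 1\<close> has \<open>k + 1\<close>; the added index \<open>Inr 1\<close>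
  plays the role of the last one.\<close>

definition homog :: "real^'m \<Rightarrow> real^('m + 1)" where
  "homog x = (\<chi> a. case a of Inl k \<Rightarrow> x $ k | Inr _ \<Rightarrow> 1)"

text \<open>\<open>sym_block_matrix H b \<beta>\<close> is \<open>[H, b; b\<^sup>T, \<beta>]\<close>.\<close>

definition sym_block_matrix :: "real^'m^'m \<Rightarrow> real^'m \<Rightarrow> real \<Rightarrow> real^('m + 1)^('m + 1)" where
  "sym_block_matrix H b \<beta> = (\<chi> r s.
     case r of Inl k \<Rightarrow> (case s of Inl l \<Rightarrow> H $ k $ l | Inr _ \<Rightarrow> b $ k)
             | Inr _ \<Rightarrow> (case s of Inl l \<Rightarrow> b $ l | Inr _ \<Rightarrow> \<beta>))"

definition upper_left_block :: "real^('m + 1)^('m + 1) \<Rightarrow> real^'m^'m" where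
  "upper_left_block A = (\<chi> k l. A $ Inl k $ Inl l)"

definition psd :: "real^'k^'k \<Rightarrow> bool" where
  "psd A \<longleftrightarrow> transpose A = A \<and> (\<forall>v. 0 \<le> v \<bullet> (A *v v))"

text \<open>The library inner product on matrices is the required one.\<close>

lemma matrix_inner_eq: "(A :: real^'k^'k) \<bullet> B = (\<Sum>i\<in>UNIV. \<Sum>j\<in>UNIV. A $ i $ j * B $ i $ j)"
  by (simp add: inner_vec_def)

text \<open>The symmetric matrix \<open>F\<close> with \<open>q x = homog x\<^sup>T F homog x\<close>; meaningful for polynomials of
  degree at most two.\<close>

definition quadratic_matrix :: "(real^'m \<Rightarrow> real) \<Rightarrow> real^('m + 1)^('m + 1)" where
  "quadratic_matrix q = (THE F. transpose F = F \<and> (\<forall>x. q x = homog x \<bullet> (F *v homog x)))"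

definition gradient :: "('a::real_inner \<Rightarrow> real) \<Rightarrow> 'a \<Rightarrow> 'a" where
  "gradient f x = (THE D. GDERIV f x :> D)"


section \<open>The triangulation problem\<close>

text \<open>The \<open>n\<close> cameras are indexed by a finite linearly ordered type \<open>'n\<close>, and the coordinates
  of \<open>\<real>\<^sup>2\<^sup>n\<close> by pairs of a camera index and one of the two image coordinates.\<close>

definition image_point :: "real^('n::finite \<times> 2) \<Rightarrow> 'n \<Rightarrow> real^2" where
  "image_point x i = (\<chi> k. x $ (i, k))"

definition epipolar :: "('n::finite \<Rightarrow> 'n \<Rightarrow> real^3^3) \<Rightarrow> 'n \<Rightarrow> 'n \<Rightarrow> real^('n \<times> 2) \<Rightarrow> real" where
  "epipolar \<Phi> i j x = homog2 (image_point x i) \<bullet> (\<Phi> i j *v homog2 (image_point x j))"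

definition objective :: "real^('n::finite \<times> 2) \<Rightarrow> real^('n \<times> 2) \<Rightarrow> real" where
  "objective xh x = (norm (x - xh))\<^sup>2"

definition F_matrix ::
  "('n::finite \<Rightarrow> 'n \<Rightarrow> real^3^3) \<Rightarrow> 'n \<Rightarrow> 'n \<Rightarrow> real^('n \<times> 2 + 1)^('n \<times> 2 + 1)" where
  "F_matrix \<Phi> i j = quadratic_matrix (epipolar \<Phi> i j)"

definition H_matrix ::
  "('n::finite \<Rightarrow> 'n \<Rightarrow> real^3^3) \<Rightarrow> 'n \<Rightarrow> 'n \<Rightarrow> real^('n \<times> 2)^('n \<times> 2)" where
  "H_matrix \<Phi> i j = upper_left_block (F_matrix \<Phi> i j)"

definition G_matrix :: "real^('n::finite \<times> 2) \<Rightarrow> real^('n \<times> 2 + 1)^('n \<times> 2 + 1)" where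
  "G_matrix xh = sym_block_matrix (mat 1) (- xh) ((norm xh)\<^sup>2)"

definition E_matrix :: "real^('n::finite \<times> 2 + 1)^('n \<times> 2 + 1)" where
  "E_matrix = sym_block_matrix 0 0 1"

definition index_pairs :: "('n::{finite,linorder} \<times> 'n) set" where
  "index_pairs = {(i, j). i < j}"

definition quad_feasible :: "('n::{finite,linorder} \<Rightarrow> 'n \<Rightarrow> real^3^3) \<Rightarrow> (real^('n \<times> 2)) set" where
  "quad_feasible \<Phi> = {x. \<forall>(i, j)\<in>index_pairs. epipolar \<Phi> i j x = 0}"

definition mom_feasible ::
  "('n::{finite,linorder} \<Rightarrow> 'n \<Rightarrow> real^3^3) \<Rightarrow> (real^('n \<times> 2 + 1)^('n \<times> 2 + 1)) set" where
  "mom_feasible \<Phi> = {Y. psd Y \<and> E_matrix \<bullet> Y = 1 \<and> (\<forall>(i, j)\<in>index_pairs. F_matrix \<Phi> i j \<bullet> Y = 0)}"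

definition sos_feasible ::
  "('n::{finite,linorder} \<Rightarrow> 'n \<Rightarrow> real^3^3) \<Rightarrow> real^('n \<times> 2) \<Rightarrow> (('n \<Rightarrow> 'n \<Rightarrow> real) \<times> real) set" where
  "sos_feasible \<Phi> xh = {(\<mu>, \<rho>).
     psd (G_matrix xh + (\<Sum>(i, j)\<in>index_pairs. \<mu> i j *\<^sub>R F_matrix \<Phi> i j) - \<rho> *\<^sub>R E_matrix)}"

text \<open>Optimal values are taken in the extended reals, so that attainment is not presupposed.\<close>

definition g_quad :: "('n::{finite,linorder} \<Rightarrow> 'n \<Rightarrow> real^3^3) \<Rightarrow> real^('n \<times> 2) \<Rightarrow> ereal" where
  "g_quad \<Phi> xh = (INF x\<in>quad_feasible \<Phi>. ereal (objective xh x))"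

definition g_mom :: "('n::{finite,linorder} \<Rightarrow> 'n \<Rightarrow> real^3^3) \<Rightarrow> real^('n \<times> 2) \<Rightarrow> ereal" where
  "g_mom \<Phi> xh = (INF Y\<in>mom_feasible \<Phi>. ereal (G_matrix xh \<bullet> Y))"

definition g_sos :: "('n::{finite,linorder} \<Rightarrow> 'n \<Rightarrow> real^3^3) \<Rightarrow> real^('n \<times> 2) \<Rightarrow> ereal" where
  "g_sos \<Phi> xh = (SUP (\<mu>, \<rho>)\<in>sos_feasible \<Phi> xh. ereal \<rho>)"

definition sdp_exact :: "('n::{finite,linorder} \<Rightarrow> 'n \<Rightarrow> real^3^3) \<Rightarrow> real^('n \<times> 2) \<Rightarrow> bool" where
  "sdp_exact \<Phi> xh \<longleftrightarrow> g_quad \<Phi> xh = g_sos \<Phi> xh \<and> g_sos \<Phi> xh = g_mom \<Phi> xh"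

definition quad_optimal ::
  "('n::{finite,linorder} \<Rightarrow> 'n \<Rightarrow> real^3^3) \<Rightarrow> real^('n \<times> 2) \<Rightarrow> real^('n \<times> 2) \<Rightarrow> bool" where
  "quad_optimal \<Phi> xh x \<longleftrightarrow>
     x \<in> quad_feasible \<Phi> \<and> (\<forall>y\<in>quad_feasible \<Phi>. objective xh x \<le> objective xh y)"


section \<open>The implicit definitions are meaningful\<close>

lemma gradient_eq: "GDERIV f x :> D \<Longrightarrow> gradient f x = D"
  unfolding gradient_def
proof (rule the_equality)
  fix D' assume "GDERIV f x :> D" "GDERIV f x :> D'"
  then have "(\<lambda>h. h \<bullet> D') = (\<lambda>h. h \<bullet> D)"
    unfolding gderiv_def by (rule has_derivative_unique[rotated])
  then have "h \<bullet> D' = h \<bullet> D" for h by (rule fun_cong)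
  then have "(D' - D) \<bullet> (D' - D) = 0"
    by (metis inner_diff_right diff_self)
  then show "D' = D" by simp
qed

lemma homog_scale:
  fixes v :: "real^('m::finite + 1)"
  assumes "v $ Inr 1 \<noteq> 0"
  shows "\<exists>x. v = (v $ Inr 1) *\<^sub>R homog x"
proof
  have "a = 1" for a :: 1 by (metis (full_types) num1_eq1)
  then show "v = (v $ Inr 1) *\<^sub>R homog (\<chi> k. v $ Inl k / v $ Inr 1)"
    using assms by (auto simp: vec_eq_iff homog_def split: sum.split)
qed

lemma symmetric_form_zero:
  fixes A :: "real^'k^'k"
  assumes sym: "transpose A = A" and zero: "\<And>v. v \<bullet> (A *v v) = 0"
  shows "A = 0"
proof -
  have comm: "u \<bullet> (A *v v) = v \<bullet> (A *v u)" for u v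
    by (metis sym dot_lmul_matrix inner_commute transpose_matrix_vector)
  have "u \<bullet> (A *v v) = 0" for u v
    using zero[of "u + v"] zero[of u] zero[of v] comm[of u v]
    by (simp add: matrix_vector_right_distrib inner_add_left inner_add_right)
  then have "A *v v = 0" for v
    by (metis inner_eq_zero_iff)
  then show ?thesis
    by (metis matrix_eq matrix_vector_mult_0)
qed

lemma quadratic_matrix_unique:
  fixes A B :: "real^('m::finite + 1)^('m + 1)"
  assumes "transpose A = A" "transpose B = B"
    and eq: "\<And>x. homog x \<bullet> (A *v homog x) = homog x \<bullet> (B *v homog x)"
  shows "A = B"
proof -
  define D where "D = A - B"
  define q where "q v = v \<bullet> (D *v v)" for v
  have sym: "transpose D = D"
    using assms(1,2) by (simp add: D_def transpose_def vec_eq_iff)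
  have q_homog: "q (homog x) = 0" for x
    using eq[of x] by (simp add: q_def D_def matrix_vector_mult_diff_rdistrib inner_diff_right)
  have q_scale: "q (c *\<^sub>R v) = c\<^sup>2 * q v" for c v
    by (simp add: q_def matrix_vector_mult_scaleR power2_eq_square)
  have q0: "q v = 0" if "v $ Inr 1 \<noteq> 0" for v
    using homog_scale[OF that] q_scale q_homog by (metis mult_zero_right)
  have "q v = 0" for v
  proof (cases "v $ Inr 1 = 0")
    case True
    define e :: "real^('m + 1)" where "e = axis (Inr 1) 1"
    have "q (v + e) = 0" "q (v - e) = 0" "q e = 0"
      using True by (auto intro!: q0 simp: e_def)
    moreover have "q (v + e) + q (v - e) = 2 * q v + 2 * q e"
      by (simp add: q_def matrix_vector_right_distrib matrix_vector_mult_diff_distrib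
          inner_add_left inner_add_right inner_diff_left inner_diff_right)
    ultimately show ?thesis by simp
  qed (rule q0)
  then have "D = 0"
    using sym by (intro symmetric_form_zero) (auto simp: q_def)
  then show ?thesis by (simp add: D_def)
qed

lemma quadratic_matrix_eq:
  assumes "transpose F = F" "\<And>x. q x = homog x \<bullet> (F *v homog x)"
  shows "quadratic_matrix q = F"
  unfolding quadratic_matrix_def
proof (rule the_equality)
  fix F' assume F': "transpose F' = F' \<and> (\<forall>x. q x = homog x \<bullet> (F' *v homog x))"
  show "F' = F"
  proof (rule quadratic_matrix_unique)
    show "homog x \<bullet> (F' *v homog x) = homog x \<bullet> (F *v homog x)" for x
      using F' assms(2)[of x] by simp
  qed (use F' assms(1) in simp_all)
next
  show "transpose F = F \<and> (\<forall>x. q x = homog x \<bullet> (F *v homog x))"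
    using assms by simp
qed

lemma F_matrix_spec:
  fixes \<Phi> :: "'n::finite \<Rightarrow> 'n \<Rightarrow> real^3^3"
  shows "transpose (F_matrix \<Phi> i j) = F_matrix \<Phi> i j"
    and "epipolar \<Phi> i j x = homog x \<bullet> (F_matrix \<Phi> i j *v homog x)"
proof -
  define S :: "'n \<Rightarrow> real^('n \<times> 2 + 1)^3" where
    "S k = vector [axis (Inl (k, 1)) 1, axis (Inl (k, 2)) 1, axis (Inr 1) 1]" for k
  have S: "S k *v homog x = homog2 (image_point x k)" for k x
    by (simp add: vec_eq_iff forall_3 S_def matrix_vector_mult_def inner_vec_def[symmetric]
        homog2_def image_point_def homog_def axis_def if_distrib if_distribR cong: if_cong)
  have inner_transpose: "u \<bullet> (transpose M *v w) = (M *v u) \<bullet> w" for M :: "real^'a^'b" and u w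
    by (metis dot_lmul_matrix inner_commute transpose_matrix_vector)
  define A where "A = transpose (S i) ** \<Phi> i j ** S j"
  have A: "epipolar \<Phi> i j x = homog x \<bullet> (A *v homog x)" for x
    by (simp add: A_def epipolar_def S[symmetric] inner_transpose matrix_vector_mul_assoc[symmetric]
          del: transpose_matrix_vector)
  have A': "epipolar \<Phi> i j x = homog x \<bullet> (transpose A *v homog x)" for x
    by (simp add: A inner_transpose inner_commute del: transpose_matrix_vector)
  define F where "F = (1/2) *\<^sub>R (A + transpose A)"
  have F: "transpose F = F" "epipolar \<Phi> i j x = homog x \<bullet> (F *v homog x)" for x
  proof -
    show "transpose F = F"
      by (simp add: F_def transpose_def vec_eq_iff)
    have "homog x \<bullet> (F *v homog x)
        = (1/2) * (homog x \<bullet> (A *v homog x) + homog x \<bullet> (transpose A *v homog x))"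
      by (simp add: F_def scaleR_matrix_vector_assoc[symmetric] matrix_vector_mult_add_rdistrib
          inner_add_right)
    then show "epipolar \<Phi> i j x = homog x \<bullet> (F *v homog x)"
      using A[of x] A'[of x] by simp
  qed
  then have "F_matrix \<Phi> i j = F"
    unfolding F_matrix_def by (rule quadratic_matrix_eq)
  then show "transpose (F_matrix \<Phi> i j) = F_matrix \<Phi> i j"
    and "epipolar \<Phi> i j x = homog x \<bullet> (F_matrix \<Phi> i j *v homog x)"
    using F by auto
qed

lemma sum_plus_1: "sum f (UNIV :: ('m::finite + 1) set) = (\<Sum>k\<in>UNIV. f (Inl k)) + f (Inr 1)"
proof -
  have "(UNIV :: ('m + 1) set) = insert (Inr 1) (range Inl)"
    by (auto simp: UNIV_sum UNIV_1)
  then have "sum f UNIV = sum f (insert (Inr 1) (range Inl))"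
    by (rule arg_cong)
  also have "\<dots> = f (Inr 1) + sum f (range Inl)"
    by (rule sum.insert) auto
  also have "sum f (range Inl) = (\<Sum>k\<in>UNIV. f (Inl k))"
    by (simp add: sum.reindex)
  finally show ?thesis by (simp only: add.commute)
qed

lemma objective_eq: "objective xh x = homog x \<bullet> (G_matrix xh *v homog x)"
proof -
  have inl: "(G_matrix xh *v homog x) $ Inl k = x $ k - xh $ k" for k
  proof -
    have "(\<Sum>l\<in>UNIV. mat 1 $ k $ l * x $ l) = x $ k"
      using arg_cong[OF matrix_vector_mul_lid[of x], of "\<lambda>w. w $ k"]
      by (simp only: matrix_vector_mult_def vec_lambda_beta)
    then show ?thesis
      by (simp add: matrix_vector_mult_def sum_plus_1 G_matrix_def sym_block_matrix_def homog_def)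
  qed
  have inr: "(G_matrix xh *v homog x) $ Inr 1 = (norm xh)\<^sup>2 - xh \<bullet> x"
    by (simp add: matrix_vector_mult_def sum_plus_1 G_matrix_def sym_block_matrix_def homog_def
        inner_vec_def sum_negf)
  have "homog x \<bullet> (G_matrix xh *v homog x)
      = (\<Sum>k\<in>UNIV. x $ k * (x $ k - xh $ k)) + ((norm xh)\<^sup>2 - xh \<bullet> x)"
    by (simp add: inner_vec_def[of "homog x"] sum_plus_1 inl inr) (simp add: homog_def)
  also have "(\<Sum>k\<in>UNIV. x $ k * (x $ k - xh $ k)) = x \<bullet> (x - xh)"
    by (simp add: inner_vec_def)
  finally show ?thesis
    by (simp add: objective_def power2_norm_eq_inner inner_diff_left inner_diff_right inner_commute)
qed

lemma forall_6: "(\<forall>i::6. P i) \<longleftrightarrow> P 1 \<and> P 2 \<and> P 3 \<and> P 4 \<and> P 5 \<and> P 6"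
proof -
  have "x = 1 \<or> x = 2 \<or> x = 3 \<or> x = 4 \<or> x = 5 \<or> x = 6" for x :: 6
  proof (induct x)
    case (of_int z)
    then have "0 \<le> z" "z < 6" by simp_all
    then have "z = 0 \<or> z = 1 \<or> z = 2 \<or> z = 3 \<or> z = 4 \<or> z = 5" by presburger
    then show ?case by auto
  qed
  then show ?thesis by (metis (full_types))
qed

lemma vector_6:
  "(vector [a,b,c,d,e,f] :: ('a::zero)^6) $ 1 = a"
  "(vector [a,b,c,d,e,f] :: ('a::zero)^6) $ 2 = b"
  "(vector [a,b,c,d,e,f] :: ('a::zero)^6) $ 3 = c"
  "(vector [a,b,c,d,e,f] :: ('a::zero)^6) $ 4 = d"
  "(vector [a,b,c,d,e,f] :: ('a::zero)^6) $ 5 = e"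
  "(vector [a,b,c,d,e,f] :: ('a::zero)^6) $ 6 = f"
  unfolding vector_def by simp_all

lemma det_row_linear: "linear (\<lambda>w. det ((\<chi> i. if i = k then w else R i) :: real^'k^'k))"
proof (rule linearI)
  fix v w :: "real^'k" and c
  show "det ((\<chi> i. if i = k then v + w else R i) :: real^'k^'k)
      = det ((\<chi> i. if i = k then v else R i) :: real^'k^'k)
        + det ((\<chi> i. if i = k then w else R i) :: real^'k^'k)"
    by (rule det_row_add)
  show "det ((\<chi> i. if i = k then c *\<^sub>R v else R i) :: real^'k^'k)
      = c *\<^sub>R det ((\<chi> i. if i = k then v else R i) :: real^'k^'k)"
    using det_row_mul[of k c "\<lambda>_. v" R, unfolded scalar_mult_eq_scaleR] by simp
qed

lemma two_view_det_linear:
  "linear (\<lambda>u. det (two_view_matrix P Q u v))" "linear (\<lambda>v. det (two_view_matrix P Q u v))"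
proof -
  define lu lv :: "real^3 \<Rightarrow> real^6"
    where "lu w = vector [w$1, w$2, w$3, 0, 0, 0]" and "lv w = vector [0, 0, 0, w$1, w$2, w$3]" for w
  have "linear lu" "linear lv"
    by (rule linearI; simp add: lu_def lv_def vec_eq_iff forall_6 vector_6)+
  have T: "transpose (two_view_matrix P Q u v)
      = (\<chi> i. if i = 5 then lu u else transpose (two_view_matrix P Q 0 v) $ i)"
    "transpose (two_view_matrix P Q u v)
      = (\<chi> i. if i = 6 then lv v else transpose (two_view_matrix P Q u 0) $ i)" for u v
    by (simp_all add: vec_eq_iff forall_6 transpose_def two_view_matrix_def vector_6 lu_def lv_def)
  have eq: "det (two_view_matrix P Q u v)
      = det (\<chi> i. if i = 5 then lu u else transpose (two_view_matrix P Q 0 v) $ i)"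
    "det (two_view_matrix P Q u v)
      = det (\<chi> i. if i = 6 then lv v else transpose (two_view_matrix P Q u 0) $ i)" for u v
    by (subst det_transpose[symmetric], rule arg_cong[OF T(1)])
      (subst det_transpose[symmetric], rule arg_cong[OF T(2)])
  show "linear (\<lambda>u. det (two_view_matrix P Q u v))"
    unfolding eq(1) using linear_compose[OF \<open>linear lu\<close> det_row_linear] by (simp only: o_def)
  show "linear (\<lambda>v. det (two_view_matrix P Q u v))"
    unfolding eq(2) using linear_compose[OF \<open>linear lv\<close> det_row_linear] by (simp only: o_def)
qed

lemma fundamental_matrix_exists: "\<exists>\<Phi>. fundamental_matrix P Q \<Phi>"
proof -
  define \<Phi> :: "real^3^3" where "\<Phi> = (\<chi> a b. det (two_view_matrix P Q (axis a 1) (axis b 1)))"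
  have "u \<bullet> (\<Phi> *v v) = det (two_view_matrix P Q u v)" for u v
  proof -
    have e: "w = (\<Sum>a\<in>UNIV. w $ a *\<^sub>R axis a 1)" for w :: "real^3"
      using basis_expansion[of w] by (simp add: scalar_mult_eq_scaleR)
    have "det (two_view_matrix P Q u v) = (\<Sum>a\<in>UNIV. u $ a * det (two_view_matrix P Q (axis a 1) v))"
      using arg_cong[OF e[of u], of "\<lambda>u. det (two_view_matrix P Q u v)"]
      by (simp only: linear_sum[OF two_view_det_linear(1)] linear_cmul[OF two_view_det_linear(1)]
          real_scaleR_def)
    moreover have "det (two_view_matrix P Q u v) = (\<Sum>b\<in>UNIV. v $ b * det (two_view_matrix P Q u (axis b 1)))" for u
      using arg_cong[OF e[of v], of "\<lambda>v. det (two_view_matrix P Q u v)"]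
      by (simp only: linear_sum[OF two_view_det_linear(2)] linear_cmul[OF two_view_det_linear(2)]
          real_scaleR_def)
    ultimately have "det (two_view_matrix P Q u v)
        = (\<Sum>a\<in>UNIV. u $ a * (\<Sum>b\<in>UNIV. v $ b * \<Phi> $ a $ b))"
      by (simp add: \<Phi>_def)
    then show ?thesis
      by (simp add: inner_vec_def matrix_vector_mult_def mult.commute)
  qed
  then show ?thesis
    unfolding fundamental_matrix_def by (metis mult_1 zero_neq_one)
qed

end

theory Submission
  imports Defs
begin

text \<open>
  For a multiplier \<open>\<mu>\<close> and a bound \<open>\<rho>\<close> let \<open>Z = G + \<Sum> \<mu>\<^sub>i\<^sub>j F\<^sub>i\<^sub>j - \<rho> E\<close> be the
  matrix that the dual program requires to be positive semidefinite. Weak duality gives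
  \<open>g\<^sup>s\<^sup>o\<^sup>s \<le> g\<^sup>m\<^sup>o\<^sup>m \<le> g\<^sup>q\<^sup>u\<^sup>a\<^sup>d\<close>, so exactness says that the supremum of the dual reaches
  \<open>\<gamma> = g(x\<^sup>*)\<close>.

  The crucial point is that the dual optimum is attained. A constraint
  \<open>f\<^sub>i\<^sub>j\<close> with \<open>i \<noteq> j\<close> is affine in each single image point, so the diagonal of \<open>H\<^sub>i\<^sub>j\<close> vanishes
  (\<open>F_matrix_diagonal_zero\<close>). Adding the identity block to the rank-one moment matrix of \<open>x\<^sup>*\<close>
  therefore leaves the moment constraints intact and yields a positive definite feasible point. By
  Slater's argument the attainable values \<open>\<rho>\<close> then form a closed set (\<open>dual_values_closed\<close>,
  \<open>sos_values_closed\<close>), and exactness means that some \<open>Z\<close> with \<open>\<rho> = \<gamma>\<close> is positive semidefinite.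

  It remains to read off what this says about \<open>\<mu>\<close>. The form of \<open>Z\<close> is the Lagrangian minus
  \<open>\<gamma>\<close>, which vanishes at \<open>x\<^sup>*\<close>. Hence a semidefinite \<open>Z\<close> annihilates the homogenization of
  \<open>x\<^sup>*\<close>, and this is the stationarity condition (\<open>stationary_iff_kernel\<close>); its upper left block
  \<open>I + \<Sum> \<mu>\<^sub>i\<^sub>j H\<^sub>i\<^sub>j\<close> is semidefinite as a principal submatrix. Conversely, modulo the kernel
  vector every vector lies in the hyperplane at infinity, on which the form of \<open>Z\<close> is that of the
  upper left block (\<open>psd_from_upper_left_block\<close>).
\<close>

section \<open>Positive semidefinite matrices\<close>

definition outer :: "real^'k \<Rightarrow> real^'k^'k" where
  "outer v = (\<chi> a b. v $ a * v $ b)"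

lemma inner_outer: "A \<bullet> outer v = v \<bullet> (A *v v)"
  by (simp add: outer_def inner_vec_def matrix_vector_mult_def sum_distrib_left mult_ac)

lemma outer_form: "w \<bullet> (outer v *v w) = (v \<bullet> w)\<^sup>2"
  by (simp add: outer_def inner_vec_def matrix_vector_mult_def power2_eq_square sum_product
      sum_distrib_left mult_ac)

lemma transpose_outer: "transpose (outer v) = outer v"
  by (simp add: outer_def transpose_def vec_eq_iff mult.commute)

lemma psd_outer: "psd (outer v)"
  by (simp add: psd_def transpose_outer outer_form)

lemma symmetric_form_commute:
  assumes "transpose A = (A :: real^'k^'k)"
  shows "u \<bullet> (A *v v) = v \<bullet> (A *v u)"
  by (metis assms dot_lmul_matrix inner_commute transpose_matrix_vector)

lemma axis_form: "axis a 1 \<bullet> ((A :: real^'k^'k) *v axis b 1) = A $ a $ b"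
  by (simp add: inner_axis' matrix_vector_mult_basis column_def)

text \<open>The form is nonnegative along the line \<open>v + t w\<close>, a quadratic polynomial in \<open>t\<close>, so its
  discriminant is at most zero.\<close>

lemma psd_Cauchy_Schwarz:
  assumes "psd A"
  shows "(v \<bullet> (A *v w))\<^sup>2 \<le> (v \<bullet> (A *v v)) * (w \<bullet> (A *v w))"
proof -
  define a b c where "a = v \<bullet> (A *v v)" and "b = v \<bullet> (A *v w)" and "c = w \<bullet> (A *v w)"
  have sym: "w \<bullet> (A *v v) = b"
    using assms by (simp add: psd_def b_def symmetric_form_commute)
  have pos: "0 \<le> a + 2 * b * t + c * t\<^sup>2" for t
  proof -
    have "0 \<le> (v + t *\<^sub>R w) \<bullet> (A *v (v + t *\<^sub>R w))"
      using assms by (simp add: psd_def)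
    also have "\<dots> = a + 2 * b * t + c * t\<^sup>2"
      by (simp add: matrix_vector_right_distrib matrix_vector_mult_scaleR inner_add_left
          inner_add_right sym a_def[symmetric] b_def[symmetric] c_def[symmetric]
          power2_eq_square algebra_simps)
    finally show ?thesis .
  qed
  have "c \<ge> 0"
    using assms by (simp add: psd_def c_def)
  have "b\<^sup>2 \<le> a * c"
  proof (cases "c = 0")
    case True
    have "b = 0"
    proof (rule ccontr)
      assume "b \<noteq> 0"
      \<comment> \<open>A nonconstant affine function takes the value \<open>-1\<close>.\<close>
      then show False
        using pos[of "- (a + 1) / (2 * b)"] True by simp
    qed
    then show ?thesis using True by simp
  next
    case False
    then have "c > 0" using \<open>c \<ge> 0\<close> by simp
    \<comment> \<open>The minimum of the polynomial over \<open>t\<close>.\<close>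
    have "0 \<le> a - b\<^sup>2 / c"
      using pos[of "- b / c"] \<open>c > 0\<close> by (simp add: power2_eq_square field_simps)
    then show ?thesis
      using \<open>c > 0\<close> by (simp add: field_simps)
  qed
  then show ?thesis
    by (simp add: a_def b_def c_def)
qed

lemma psd_entry_bound:
  assumes "psd A"
  shows "(A $ a $ b)\<^sup>2 \<le> A $ a $ a * A $ b $ b"
  using psd_Cauchy_Schwarz[OF assms, of "axis a 1" "axis b 1"] by (simp only: axis_form)

lemma psd_diagonal_nonneg: "psd A \<Longrightarrow> 0 \<le> A $ a $ a"
  unfolding psd_def by (metis axis_form)

lemma psd_form_zero_imp_kernel:
  assumes "psd A" "v \<bullet> (A *v v) = 0"
  shows "A *v v = 0"
  using psd_Cauchy_Schwarz[OF assms(1), of "A *v v" v] assms(2) by simp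

lemma psd_norm_le_trace:
  assumes "psd (A :: real^'k^'k)"
  shows "norm A \<le> trace A"
proof -
  have nonneg: "0 \<le> trace A"
    unfolding trace_def by (intro sum_nonneg psd_diagonal_nonneg assms)
  have "(norm A)\<^sup>2 = (\<Sum>a\<in>UNIV. \<Sum>b\<in>UNIV. (A $ a $ b)\<^sup>2)"
    unfolding power2_norm_eq_inner by (simp add: inner_vec_def power2_eq_square)
  also have "\<dots> \<le> (\<Sum>a\<in>UNIV. \<Sum>b\<in>UNIV. A $ a $ a * A $ b $ b)"
    by (intro sum_mono psd_entry_bound assms)
  also have "\<dots> = (trace A)\<^sup>2"
    by (simp add: trace_def power2_eq_square sum_product)
  finally show ?thesis
    using nonneg by (rule power2_le_imp_le)
qed

text \<open>Self-duality of the semidefinite cone. One step of symmetric Gaussian elimination splits a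
  rank-one matrix \<open>outer r\<close> off \<open>Y\<close>, on which the pairing with \<open>Z\<close> is the value of a
  nonnegative form; the remainder stays semidefinite and has fewer nonzero diagonal entries.\<close>

lemma psd_inner_nonneg:
  assumes "psd (Z :: real^'k^'k)" "psd (Y :: real^'k^'k)"
  shows "0 \<le> Z \<bullet> Y"
  using assms(2)
proof (induction "card {a. Y $ a $ a \<noteq> 0}" arbitrary: Y rule: less_induct)
  case less
  show ?case
  proof (cases "\<exists>a. Y $ a $ a \<noteq> 0")
    case False
    then have "Y = 0"
      using psd_entry_bound[OF less.prems] by (simp add: vec_eq_iff)
    then show ?thesis by simp
  next
    case True
    then obtain a where a: "Y $ a $ a \<noteq> 0" by blast
    then have apos: "Y $ a $ a > 0"
      using psd_diagonal_nonneg[OF less.prems, of a] by simp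
    define r where "r = Y *v axis a 1"
    define Y' where "Y' = Y - (1 / Y $ a $ a) *\<^sub>R outer r"
    have r: "r $ b = Y $ b $ a" for b
      by (simp add: r_def matrix_vector_mult_basis column_def)
    have sym: "Y $ a $ b = Y $ b $ a" for b
      using less.prems by (simp add: psd_def transpose_def vec_eq_iff)
    have form: "v \<bullet> (Y' *v v) = v \<bullet> (Y *v v) - (v \<bullet> r)\<^sup>2 / Y $ a $ a" for v
      by (simp add: Y'_def matrix_vector_mult_diff_rdistrib scaleR_matrix_vector_assoc[symmetric]
          inner_diff_right outer_form inner_commute)
    have psd': "psd Y'"
      unfolding psd_def
    proof (intro conjI allI)
      show "transpose Y' = Y'"
        using less.prems
        by (simp add: psd_def Y'_def transpose_def vec_eq_iff outer_def mult.commute)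
      show "0 \<le> v \<bullet> (Y' *v v)" for v
        using psd_Cauchy_Schwarz[OF less.prems, of v "axis a 1"] apos
        by (simp add: form axis_form r_def[symmetric]) (simp add: r_def axis_form field_simps)
    qed
    have "Y' $ b $ b = Y $ b $ b - (Y $ b $ a)\<^sup>2 / Y $ a $ a" for b
      by (simp add: Y'_def outer_def r power2_eq_square)
    moreover have "Y $ b $ b = 0 \<Longrightarrow> Y $ b $ a = 0" for b
      using psd_entry_bound[OF less.prems, of b a] by simp
    ultimately have "{b. Y' $ b $ b \<noteq> 0} \<subseteq> {b. Y $ b $ b \<noteq> 0}" and "Y' $ a $ a = 0"
      using a by (auto simp: power2_eq_square)
    then have "{b. Y' $ b $ b \<noteq> 0} \<subset> {b. Y $ b $ b \<noteq> 0}"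
      using a by blast
    then have "card {b. Y' $ b $ b \<noteq> 0} < card {b. Y $ b $ b \<noteq> 0}"
      by (intro psubset_card_mono) auto
    then have "0 \<le> Z \<bullet> Y'"
      using psd' by (rule less.hyps)
    moreover have "Z \<bullet> Y = Z \<bullet> Y' + (1 / Y $ a $ a) * (r \<bullet> (Z *v r))"
      by (simp add: Y'_def inner_diff_right inner_outer)
    ultimately show ?thesis
      using assms(1) apos by (simp add: psd_def)
  qed
qed

lemma closed_psd: "closed {A :: real^'k^'k. psd A}"
proof -
  have "{A :: real^'k^'k. psd A}
      = {A. \<forall>a b. A $ b $ a = A $ a $ b} \<inter> {A. \<forall>v. 0 \<le> A \<bullet> outer v}"
    by (auto simp: psd_def inner_outer transpose_def vec_eq_iff)
  moreover have "closed {A :: real^'k^'k. \<forall>a b. A $ b $ a = A $ a $ b}"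
    by (intro closed_Collect_all closed_Collect_eq continuous_intros)
  moreover have "closed {A :: real^'k^'k. \<forall>v. 0 \<le> A \<bullet> outer v}"
    by (intro closed_Collect_all closed_Collect_le continuous_intros)
  ultimately show ?thesis by (simp only: closed_Int)
qed

lemma positive_definite_dominates_identity:
  fixes Y :: "real^'k^'k"
  assumes "transpose Y = Y" "\<And>v. v \<noteq> 0 \<Longrightarrow> 0 < v \<bullet> (Y *v v)"
  obtains c where "c > 0" "psd (Y - c *\<^sub>R mat 1)"
proof -
  have "continuous_on (sphere 0 1) (\<lambda>v. v \<bullet> (Y *v v))"
    by (intro continuous_intros linear_continuous_on
        linear_linear[THEN iffD2, OF matrix_vector_mul_linear])
  moreover have "sphere (0 :: real^'k) 1 \<noteq> {}" by simp
  ultimately have "\<exists>u\<in>sphere 0 1. \<forall>v\<in>sphere 0 1. u \<bullet> (Y *v u) \<le> v \<bullet> (Y *v v)"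
    by (intro continuous_attains_inf compact_sphere)
  then obtain u where u: "u \<in> sphere 0 1"
    "\<And>v. v \<in> sphere 0 1 \<Longrightarrow> u \<bullet> (Y *v u) \<le> v \<bullet> (Y *v v)"
    by blast
  define c where "c = u \<bullet> (Y *v u)"
  have "u \<noteq> 0" using u(1) by auto
  have bound: "c * (v \<bullet> v) \<le> v \<bullet> (Y *v v)" for v
  proof (cases "v = 0")
    case False
    then have "c \<le> (v /\<^sub>R norm v) \<bullet> (Y *v (v /\<^sub>R norm v))"
      unfolding c_def by (intro u(2)) simp
    then show ?thesis
      using False
      by (simp add: matrix_vector_mult_scaleR power2_norm_eq_inner[symmetric] field_simps
          power2_eq_square)
  qed simp
  show thesis
  proof
    show "c > 0" using assms(2)[OF \<open>u \<noteq> 0\<close>] by (simp add: c_def)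
    show "psd (Y - c *\<^sub>R mat 1)"
      unfolding psd_def
    proof (intro conjI allI)
      show "transpose (Y - c *\<^sub>R mat 1) = Y - c *\<^sub>R mat 1"
        using assms(1) by (simp add: transpose_def vec_eq_iff mat_def)
      show "0 \<le> v \<bullet> ((Y - c *\<^sub>R mat 1) *v v)" for v
        using bound[of v]
        by (simp add: matrix_vector_mult_diff_rdistrib scaleR_matrix_vector_assoc[symmetric]
            inner_diff_right)
    qed
  qed
qed

section \<open>Attainment of the dual optimum\<close>

text \<open>A positive definite \<open>Y\<close> orthogonal to all \<open>F i\<close> makes the dual values closed: for a dual
  slack matrix \<open>Z\<close> the number \<open>\<langle>Z, Y\<rangle>\<close> depends only on \<open>\<rho>\<close>, and it dominates a multiple
  of the trace of \<open>Z\<close>, hence its norm. So along a convergent sequence of values the slack matrices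
  stay bounded. The multipliers need not, since the \<open>F i\<close> may be dependent; the limit is
  therefore taken in the span of the \<open>F i\<close>, and new multipliers are chosen there.\<close>

lemma dual_values_closed:
  fixes F :: "'i \<Rightarrow> real^'k^'k" and C E Y :: "real^'k^'k"
  assumes Y: "transpose Y = Y" "\<And>v. v \<noteq> 0 \<Longrightarrow> 0 < v \<bullet> (Y *v v)"
    and orth: "\<And>i. i \<in> I \<Longrightarrow> F i \<bullet> Y = 0"
  shows "closed {\<rho>. \<exists>\<mu>. psd (C + (\<Sum>i\<in>I. \<mu> i *\<^sub>R F i) - \<rho> *\<^sub>R E)}"
  unfolding closed_sequential_limits
proof (intro allI impI, elim conjE)
  fix \<rho> l
  assume mem: "\<forall>n. \<rho> n \<in> {\<rho>. \<exists>\<mu>. psd (C + (\<Sum>i\<in>I. \<mu> i *\<^sub>R F i) - \<rho> *\<^sub>R E)}"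
    and lim: "\<rho> \<longlonglongrightarrow> l"
  from mem obtain \<mu> where \<mu>: "\<And>n. psd (C + (\<Sum>i\<in>I. \<mu> n i *\<^sub>R F i) - \<rho> n *\<^sub>R E)"
    by (auto simp: choice_iff)
  define Z where "Z n = C + (\<Sum>i\<in>I. \<mu> n i *\<^sub>R F i) - \<rho> n *\<^sub>R E" for n
  have psd_Z: "psd (Z n)" for n
    using \<mu> by (simp add: Z_def)
  obtain c where c: "c > 0" "psd (Y - c *\<^sub>R mat 1)"
    using positive_definite_dominates_identity[OF Y] by blast
  obtain B where B: "\<And>n. \<bar>\<rho> n\<bar> \<le> B"
    using convergent_imp_bounded[OF lim] by (auto simp: bounded_iff)
  have "norm (Z n) \<le> (C \<bullet> Y + B * \<bar>E \<bullet> Y\<bar>) / c" for n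
  proof -
    have tr: "Z n \<bullet> mat 1 = trace (Z n)"
      by (simp add: inner_vec_def mat_def trace_def if_distrib if_distribR cong: if_cong)
    have "0 \<le> Z n \<bullet> (Y - c *\<^sub>R mat 1)"
      using psd_Z c(2) by (rule psd_inner_nonneg)
    then have "c * trace (Z n) \<le> Z n \<bullet> Y"
      by (simp add: inner_diff_right tr)
    also have "Z n \<bullet> Y = C \<bullet> Y - \<rho> n * (E \<bullet> Y)"
      by (simp add: Z_def inner_diff_left inner_add_left inner_sum_left orth)
    also have "\<dots> \<le> C \<bullet> Y + B * \<bar>E \<bullet> Y\<bar>"
      using mult_right_mono[OF B[of n], of "\<bar>E \<bullet> Y\<bar>"]
        abs_ge_minus_self[of "\<rho> n * (E \<bullet> Y)"] by (simp add: abs_mult)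
    finally have "c * norm (Z n) \<le> C \<bullet> Y + B * \<bar>E \<bullet> Y\<bar>"
      using mult_left_mono[OF psd_norm_le_trace[OF psd_Z[of n]], of c] c(1) by linarith
    then show ?thesis
      using c(1) by (simp add: field_simps)
  qed
  then have "bounded (range Z)"
    unfolding bounded_iff by blast
  then obtain Z0 r where r: "strict_mono r" and Z0: "(Z \<circ> r) \<longlonglongrightarrow> Z0"
    using bounded_imp_convergent_subsequence by blast
  have "psd Z0"
    using closed_sequentially[OF closed_psd _ Z0] psd_Z by simp
  define S where "S = {\<Sum>i\<in>I. \<nu> i *\<^sub>R F i | \<nu>. True}"
  have "subspace S"
  proof (rule subspaceI)
    show "0 \<in> S"
      by (auto simp: S_def intro!: exI[of _ "\<lambda>_. 0"])
  next
    fix x y assume "x \<in> S" "y \<in> S"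
    then obtain \<nu> \<nu>' where "x = (\<Sum>i\<in>I. \<nu> i *\<^sub>R F i)" "y = (\<Sum>i\<in>I. \<nu>' i *\<^sub>R F i)"
      by (auto simp: S_def)
    then have "x + y = (\<Sum>i\<in>I. (\<nu> i + \<nu>' i) *\<^sub>R F i)"
      by (simp add: scaleR_add_left sum.distrib)
    then show "x + y \<in> S"
      unfolding S_def by (intro CollectI exI[of _ "\<lambda>i. \<nu> i + \<nu>' i"]) simp
  next
    fix x and t :: real assume "x \<in> S"
    then obtain \<nu> where "x = (\<Sum>i\<in>I. \<nu> i *\<^sub>R F i)"
      by (auto simp: S_def)
    then have "t *\<^sub>R x = (\<Sum>i\<in>I. (t * \<nu> i) *\<^sub>R F i)"
      by (simp add: scaleR_sum_right)
    then show "t *\<^sub>R x \<in> S"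
      unfolding S_def by (intro CollectI exI[of _ "\<lambda>i. t * \<nu> i"]) simp
  qed
  have "(\<lambda>n. (Z \<circ> r) n + (\<rho> \<circ> r) n *\<^sub>R E - C) \<longlonglongrightarrow> Z0 + l *\<^sub>R E - C"
    by (intro tendsto_intros Z0 LIMSEQ_subseq_LIMSEQ[OF lim r])
  moreover have "(Z \<circ> r) n + (\<rho> \<circ> r) n *\<^sub>R E - C \<in> S" for n
    by (auto simp: Z_def S_def)
  ultimately have "Z0 + l *\<^sub>R E - C \<in> S"
    by (rule closed_sequentially[OF closed_subspace[OF \<open>subspace S\<close>], rotated])
  then obtain \<nu> where "Z0 + l *\<^sub>R E - C = (\<Sum>i\<in>I. \<nu> i *\<^sub>R F i)"
    by (auto simp: S_def)
  then have "Z0 = C + (\<Sum>i\<in>I. \<nu> i *\<^sub>R F i) - l *\<^sub>R E"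
    by (simp add: algebra_simps)
  then show "l \<in> {\<rho>. \<exists>\<mu>. psd (C + (\<Sum>i\<in>I. \<mu> i *\<^sub>R F i) - \<rho> *\<^sub>R E)}"
    using \<open>psd Z0\<close> by auto
qed

section \<open>Homogeneous coordinates\<close>

text \<open>Homogeneous coordinates of the point at infinity in direction \<open>w\<close>.\<close>

definition direction :: "real^'m \<Rightarrow> real^('m + 1)" where
  "direction w = (\<chi> a. case a of Inl k \<Rightarrow> w $ k | Inr _ \<Rightarrow> 0)"

definition affine_part :: "real^('m + 1) \<Rightarrow> real^'m" where
  "affine_part v = (\<chi> k. v $ Inl k)"

lemma inner_direction: "direction w \<bullet> v = w \<bullet> affine_part v"
  by (simp add: inner_vec_def sum_plus_1 direction_def affine_part_def)

lemma inner_homog: "homog x \<bullet> v = v $ Inr 1 + x \<bullet> affine_part v"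
  by (simp add: inner_vec_def sum_plus_1 homog_def affine_part_def)

lemma direction_form: "direction w \<bullet> (A *v direction w) = w \<bullet> (upper_left_block A *v w)"
  by (simp add: inner_vec_def sum_plus_1 direction_def upper_left_block_def matrix_vector_mult_def)

lemma homog_add: "homog (x + h) = homog x + direction h"
  by (simp add: homog_def direction_def vec_eq_iff split: sum.split)

lemma plus_1_vec_eq_iff:
  "u = v \<longleftrightarrow> affine_part u = affine_part v \<and> u $ Inr 1 = (v $ Inr 1 :: real)"
proof -
  have "a = 1" for a :: 1 by (metis (full_types) num1_eq1)
  then show ?thesis
    unfolding vec_eq_iff affine_part_def vec_lambda_beta by (metis (full_types) sum.exhaust)
qed

lemma affine_part_simps [simp]:
  "affine_part (homog x) = x" "affine_part (direction w) = w" "affine_part 0 = 0"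
  "affine_part (u + v) = affine_part u + affine_part v"
  "affine_part (u - v) = affine_part u - affine_part v"
  "affine_part (c *\<^sub>R v) = c *\<^sub>R affine_part v"
  by (simp_all add: affine_part_def homog_def direction_def vec_eq_iff)

lemma affine_part_axis_last [simp]: "affine_part (axis (Inr 1) c) = 0"
  by (simp add: affine_part_def vec_eq_iff axis_def)

lemma last_simps [simp]: "homog x $ Inr 1 = 1" "direction w $ Inr 1 = 0"
  by (simp_all add: homog_def direction_def)

lemma affine_part_sum: "affine_part (sum f I) = (\<Sum>i\<in>I. affine_part (f i))"
  by (simp add: affine_part_def vec_eq_iff)

lemma homog_decomposition:
  "v = (v $ Inr 1) *\<^sub>R homog x + direction (affine_part v - (v $ Inr 1) *\<^sub>R x)"
  by (subst plus_1_vec_eq_iff) simp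

lemma psd_upper_left_block:
  assumes "psd A" shows "psd (upper_left_block A)"
proof -
  have "transpose (upper_left_block A) = upper_left_block A"
    using assms by (simp add: psd_def upper_left_block_def transpose_def vec_eq_iff)
  then show ?thesis
    using assms unfolding psd_def by (metis direction_form)
qed

text \<open>Modulo \<open>homog x\<close> every vector is a direction. If \<open>homog x\<close> lies in the kernel, the form
  is thus determined by its restriction to the directions.\<close>

lemma psd_from_upper_left_block:
  fixes A :: "real^('m::finite + 1)^('m + 1)"
  assumes sym: "transpose A = A" and ker: "A *v homog x = 0" and ul: "psd (upper_left_block A)"
  shows "psd A"
  unfolding psd_def
proof (intro conjI allI sym)
  fix v
  define t w where "t = v $ Inr 1" and "w = affine_part v - t *\<^sub>R x"
  have v: "v = t *\<^sub>R homog x + direction w"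
    unfolding t_def w_def by (rule homog_decomposition)
  have Av: "A *v v = A *v direction w"
    by (simp add: v matrix_vector_right_distrib matrix_vector_mult_scaleR ker)
  have "homog x \<bullet> (A *v direction w) = 0"
    by (subst symmetric_form_commute[OF sym]) (simp add: ker)
  then have "v \<bullet> (A *v v) = direction w \<bullet> (A *v direction w)"
    unfolding Av by (subst v) (simp add: inner_add_left)
  also have "\<dots> \<ge> 0"
    using ul by (simp add: direction_form psd_def)
  finally show "0 \<le> v \<bullet> (A *v v)" .
qed

lemma homogenized_form_gradient:
  fixes A :: "real^('m::finite + 1)^('m + 1)"
  assumes "transpose A = A" "\<And>y. q y = homog y \<bullet> (A *v homog y)"
  shows "gradient q x = 2 *\<^sub>R affine_part (A *v homog x)"
proof (rule gradient_eq)
  define M where "M = upper_left_block A"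
  have homog0: "homog y = homog 0 + direction y" for y :: "real^'m"
    using homog_add[of 0 y] by simp
  have q: "q y = homog 0 \<bullet> (A *v homog 0) + 2 * (y \<bullet> affine_part (A *v homog 0)) + y \<bullet> (M *v y)"
    for y
  proof -
    have "homog 0 \<bullet> (A *v direction y) = direction y \<bullet> (A *v homog 0)"
      by (rule symmetric_form_commute[OF assms(1)])
    then show ?thesis
      unfolding assms(2) homog0[of y]
      by (simp add: matrix_vector_right_distrib inner_add_left inner_add_right direction_form
          inner_direction[of y "A *v homog 0"] M_def)
  qed
  have lin: "bounded_linear ((*v) M)"
    by (simp add: linear_conv_bounded_linear[symmetric])
  have Mx: "h \<bullet> (M *v x) = x \<bullet> (M *v h)" for h
    using assms(1)
    by (intro symmetric_form_commute) (simp add: M_def upper_left_block_def transpose_def vec_eq_iff)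
  have "affine_part (A *v direction x) = M *v x"
    by (simp add: M_def vec_eq_iff affine_part_def matrix_vector_mult_def sum_plus_1
        upper_left_block_def direction_def)
  then have grad: "affine_part (A *v homog x) = affine_part (A *v homog 0) + M *v x"
    unfolding homog0[of x] by (simp add: matrix_vector_right_distrib)
  show "GDERIV q x :> 2 *\<^sub>R affine_part (A *v homog x)"
    unfolding gderiv_def q[abs_def] grad
    by (rule derivative_eq_intros bounded_linear.has_derivative[OF lin] refl)+
      (simp add: fun_eq_iff inner_add_right Mx)
qed

lemma identity_block_mult:
  "sym_block_matrix (mat 1) 0 0 *v v = direction (affine_part v)"
proof -
  have "affine_part (sym_block_matrix (mat 1) 0 0 *v v) = mat 1 *v affine_part v"
    by (simp add: sym_block_matrix_def affine_part_def vec_eq_iff matrix_vector_mult_def sum_plus_1)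
  moreover have "(sym_block_matrix (mat 1) 0 0 *v v) $ Inr 1 = 0"
    by (simp add: matrix_vector_mult_def sum_plus_1 sym_block_matrix_def)
  ultimately show ?thesis
    by (subst plus_1_vec_eq_iff) simp
qed

section \<open>The Lagrangian of the triangulation problem\<close>

definition lagrangian_matrix ::
  "('n::{finite,linorder} \<Rightarrow> 'n \<Rightarrow> real^3^3) \<Rightarrow> real^('n \<times> 2) \<Rightarrow> ('n \<Rightarrow> 'n \<Rightarrow> real) \<Rightarrow> real
    \<Rightarrow> real^('n \<times> 2 + 1)^('n \<times> 2 + 1)" where
  "lagrangian_matrix \<Phi> xh \<mu> \<rho> =
     G_matrix xh + (\<Sum>(i, j)\<in>index_pairs. \<mu> i j *\<^sub>R F_matrix \<Phi> i j) - \<rho> *\<^sub>R E_matrix"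

lemma F_matrix_diagonal_zero:
  fixes \<Phi> :: "'n::finite \<Rightarrow> 'n \<Rightarrow> real^3^3"
  assumes "i \<noteq> j"
  shows "F_matrix \<Phi> i j $ Inl a $ Inl a = 0"
proof -
  \<comment> \<open>The entry is half the second difference of the epipolar form along a coordinate axis, and a
    single axis moves only one of the two image points, on which the form depends affinely.\<close>
  define e :: "real^('n \<times> 2)" where "e = axis a 1"
  define F where "F = F_matrix \<Phi> i j"
  have opposite: "homog2 (image_point (- e) l) = homog2 (image_point 0 l) + homog2 (image_point 0 l)
      - homog2 (image_point e l)"
    for l
    by (simp add: homog2_def image_point_def vec_eq_iff forall_3)
  have absent: "homog2 (image_point e l) = homog2 (image_point 0 l)" if "l \<noteq> fst a" for l
  proof -
    have "e $ (l, k) = 0" for k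
      using that by (auto simp: e_def axis_def)
    then show ?thesis
      by (simp add: homog2_def image_point_def)
  qed
  have "epipolar \<Phi> i j e + epipolar \<Phi> i j (- e) = 2 * epipolar \<Phi> i j 0"
  proof (cases "i = fst a")
    case True
    then have "j \<noteq> fst a" using assms by simp
    from absent[OF this] show ?thesis
      unfolding epipolar_def opposite inner_diff_left inner_add_left by simp
  next
    case False
    from absent[OF this] show ?thesis
      unfolding epipolar_def opposite
      unfolding matrix_vector_mult_diff_distrib matrix_vector_right_distrib
        inner_diff_right inner_add_right by simp
  qed
  moreover have homog: "homog e = homog 0 + direction e" "homog (- e) = homog 0 - direction e"
    by (simp_all add: plus_1_vec_eq_iff)
  ultimately have "direction e \<bullet> (F *v direction e) = 0"
    unfolding F_matrix_spec(2) F_def[symmetric] homog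
    by (simp add: matrix_vector_right_distrib matrix_vector_mult_diff_distrib
        inner_add_left inner_add_right inner_diff_left inner_diff_right)
  then show ?thesis
    unfolding direction_form e_def axis_form by (simp add: upper_left_block_def F_def)
qed

lemma E_matrix_mult: "E_matrix *v v = axis (Inr 1) (v $ Inr 1)"
  by (subst plus_1_vec_eq_iff)
    (simp add: E_matrix_def sym_block_matrix_def affine_part_def matrix_vector_mult_def sum_plus_1
      vec_eq_iff axis_def)

lemma transpose_sym_block_matrix:
  assumes "transpose H = H"
  shows "transpose (sym_block_matrix H b \<beta>) = sym_block_matrix H b \<beta>"
  using assms by (auto simp: sym_block_matrix_def transpose_def vec_eq_iff split: sum.split)

lemma transpose_G_matrix: "transpose (G_matrix xh) = G_matrix xh"
  unfolding G_matrix_def by (intro transpose_sym_block_matrix transpose_mat)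

lemma transpose_lagrangian_matrix:
  fixes \<Phi> :: "'n::{finite,linorder} \<Rightarrow> 'n \<Rightarrow> real^3^3"
  shows "transpose (lagrangian_matrix \<Phi> xh \<mu> \<rho>) = lagrangian_matrix \<Phi> xh \<mu> \<rho>"
proof -
  have entry: "lagrangian_matrix \<Phi> xh \<mu> \<rho> $ a $ b = G_matrix xh $ a $ b
      + (\<Sum>(i, j)\<in>index_pairs. \<mu> i j * F_matrix \<Phi> i j $ a $ b) - \<rho> * E_matrix $ a $ b" for a b
    by (simp add: lagrangian_matrix_def split_def)
  have F: "F_matrix \<Phi> i j $ a $ b = F_matrix \<Phi> i j $ b $ a" for i j a b
    using arg_cong[OF F_matrix_spec(1)[of \<Phi> i j], of "\<lambda>M. M $ b $ a"] by (simp add: transpose_def)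
  have G: "G_matrix xh $ a $ b = G_matrix xh $ b $ a" for a b
    using arg_cong[OF transpose_G_matrix[of xh], of "\<lambda>M. M $ b $ a"] by (simp add: transpose_def)
  have E: "(E_matrix :: real^('n \<times> 2 + 1)^('n \<times> 2 + 1)) $ a $ b = E_matrix $ b $ a" for a b
    by (simp add: E_matrix_def sym_block_matrix_def split: sum.split)
  have "lagrangian_matrix \<Phi> xh \<mu> \<rho> $ b $ a = lagrangian_matrix \<Phi> xh \<mu> \<rho> $ a $ b" for a b
    unfolding entry by (simp only: F[of _ _ b a] G[of b a] E[of b a])
  then show ?thesis
    by (simp add: transpose_def vec_eq_iff)
qed

lemma matrix_sum_vector_mult: "(\<Sum>p\<in>I. A p) *v v = (\<Sum>p\<in>I. (A p :: real^'k^'l) *v v)"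
  by (induction I rule: infinite_finite_induct) (simp_all add: matrix_vector_mult_add_rdistrib)

lemma lagrangian_matrix_mult:
  "lagrangian_matrix \<Phi> xh \<mu> \<rho> *v v
    = G_matrix xh *v v + (\<Sum>(i, j)\<in>index_pairs. \<mu> i j *\<^sub>R (F_matrix \<Phi> i j *v v))
      - \<rho> *\<^sub>R axis (Inr 1) (v $ Inr 1)"
  by (simp add: lagrangian_matrix_def matrix_vector_mult_diff_rdistrib
      matrix_vector_mult_add_rdistrib matrix_sum_vector_mult split_def
      scaleR_matrix_vector_assoc[symmetric] E_matrix_mult)

lemma lagrangian_value:
  assumes "x \<in> quad_feasible \<Phi>"
  shows "homog x \<bullet> (lagrangian_matrix \<Phi> xh \<mu> \<rho> *v homog x) = objective xh x - \<rho>"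
proof -
  have "(\<Sum>(i, j)\<in>index_pairs. \<mu> i j * (homog x \<bullet> (F_matrix \<Phi> i j *v homog x))) = 0"
    using assms by (intro sum.neutral) (auto simp: quad_feasible_def F_matrix_spec(2)[symmetric])
  then show ?thesis
    by (simp add: lagrangian_matrix_mult inner_diff_right inner_add_right inner_sum_right split_def
        objective_eq[symmetric] inner_axis)
qed

text \<open>The gradient does not see \<open>\<rho>\<close>: \<open>E\<close> contributes only to the last coordinate.\<close>

lemma lagrangian_gradient:
  "gradient (objective xh) x + (\<Sum>(i, j)\<in>index_pairs. \<mu> i j *\<^sub>R gradient (epipolar \<Phi> i j) x)
    = 2 *\<^sub>R affine_part (lagrangian_matrix \<Phi> xh \<mu> \<rho> *v homog x)"
  by (simp add: lagrangian_matrix_mult affine_part_sum split_def scaleR_sum_right scaleR_add_right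
      homogenized_form_gradient[OF transpose_G_matrix objective_eq]
      homogenized_form_gradient[OF F_matrix_spec] mult.commute)

lemma upper_left_lagrangian:
  "upper_left_block (lagrangian_matrix \<Phi> xh \<mu> \<rho>)
    = mat 1 + (\<Sum>(i, j)\<in>index_pairs. \<mu> i j *\<^sub>R H_matrix \<Phi> i j)"
  by (simp add: upper_left_block_def lagrangian_matrix_def H_matrix_def G_matrix_def E_matrix_def
      sym_block_matrix_def vec_eq_iff split_def)

text \<open>Stationarity only kills the coordinates of \<open>Z homog x\<close> other than the last one; the last one
  then vanishes because the form of \<open>Z\<close> is zero at \<open>homog x\<close>, by the choice of \<open>\<rho>\<close>.\<close>

lemma stationary_iff_kernel:
  assumes "x \<in> quad_feasible \<Phi>"
  shows "gradient (objective xh) x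
      + (\<Sum>(i, j)\<in>index_pairs. \<mu> i j *\<^sub>R gradient (epipolar \<Phi> i j) x) = 0
    \<longleftrightarrow> lagrangian_matrix \<Phi> xh \<mu> (objective xh x) *v homog x = 0"
    (is "?g = 0 \<longleftrightarrow> ?L = 0")
proof -
  have "?g = 0 \<longleftrightarrow> affine_part ?L = 0"
    by (subst lagrangian_gradient) simp
  moreover have "?L $ Inr 1 = 0" if "affine_part ?L = 0"
  proof -
    have "homog x \<bullet> ?L = ?L $ Inr 1"
      using that by (simp add: inner_homog)
    then show ?thesis
      using lagrangian_value[OF assms] by simp
  qed
  ultimately show ?thesis
    by (subst plus_1_vec_eq_iff) auto
qed

section \<open>Duality\<close>

lemma g_mom_le_g_quad: "g_mom \<Phi> xh \<le> g_quad \<Phi> xh"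
  unfolding g_quad_def
proof (rule INF_greatest)
  fix x assume x: "x \<in> quad_feasible \<Phi>"
  have "outer (homog x) \<in> mom_feasible \<Phi>"
    using x by (auto simp: mom_feasible_def psd_outer inner_outer E_matrix_mult inner_axis
        F_matrix_spec(2)[symmetric] quad_feasible_def)
  then show "g_mom \<Phi> xh \<le> ereal (objective xh x)"
    unfolding g_mom_def by (rule INF_lower2) (simp add: inner_outer objective_eq)
qed

lemma g_sos_le_g_mom: "g_sos \<Phi> xh \<le> g_mom \<Phi> xh"
  unfolding g_sos_def g_mom_def
proof (rule SUP_least, rule INF_greatest)
  fix p Y assume p: "p \<in> sos_feasible \<Phi> xh" and Y: "Y \<in> mom_feasible \<Phi>"
  obtain \<mu> \<rho> where p_eq: "p = (\<mu>, \<rho>)" by force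
  have "psd (lagrangian_matrix \<Phi> xh \<mu> \<rho>)"
    using p by (simp add: p_eq sos_feasible_def lagrangian_matrix_def)
  then have "0 \<le> lagrangian_matrix \<Phi> xh \<mu> \<rho> \<bullet> Y"
    using Y by (intro psd_inner_nonneg) (auto simp: mom_feasible_def)
  moreover have "(\<Sum>(i, j)\<in>index_pairs. \<mu> i j * (F_matrix \<Phi> i j \<bullet> Y)) = 0"
    using Y by (intro sum.neutral) (auto simp: mom_feasible_def)
  ultimately have "\<rho> \<le> G_matrix xh \<bullet> Y"
    using Y by (simp add: lagrangian_matrix_def inner_diff_left inner_add_left inner_sum_left
        split_def mom_feasible_def)
  then show "(case p of (\<mu>, \<rho>) \<Rightarrow> ereal \<rho>) \<le> ereal (G_matrix xh \<bullet> Y)"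
    by (simp add: p_eq)
qed

lemma g_quad_optimal: "quad_optimal \<Phi> xh x \<Longrightarrow> g_quad \<Phi> xh = ereal (objective xh x)"
  unfolding g_quad_def quad_optimal_def
  by (intro antisym INF_lower INF_greatest) auto

lemma sdp_exact_iff_sos_bound:
  assumes "quad_optimal \<Phi> xh x"
  shows "sdp_exact \<Phi> xh \<longleftrightarrow> ereal (objective xh x) \<le> g_sos \<Phi> xh"
  using g_sos_le_g_mom[of \<Phi> xh] g_mom_le_g_quad[of \<Phi> xh] g_quad_optimal[OF assms]
  unfolding sdp_exact_def by (metis antisym order.refl order.trans)

text \<open>The strictly feasible moment matrix is that of a random point with mean \<open>x\<close> and identity
  covariance: the epipolar constraints, with no squares in them, still hold on average.\<close>

lemma sos_values_closed:
  assumes "x \<in> quad_feasible \<Phi>"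
  shows "closed {\<rho>. \<exists>\<mu>. (\<mu>, \<rho>) \<in> sos_feasible \<Phi> xh}"
proof -
  define F where "F = (\<lambda>(i, j). F_matrix \<Phi> i j)"
  define D :: "real^('a \<times> 2 + 1)^('a \<times> 2 + 1)" where "D = sym_block_matrix (mat 1) 0 0"
  define Y where "Y = outer (homog x) + D"
  have D_mult: "D *v v = direction (affine_part v)" for v
    unfolding D_def by (rule identity_block_mult)
  have "transpose D = D"
    unfolding D_def by (intro transpose_sym_block_matrix transpose_mat)
  then have "transpose Y = Y"
    using transpose_outer[of "homog x"] by (simp add: Y_def transpose_def vec_eq_iff)
  moreover have "0 < v \<bullet> (Y *v v)" if "v \<noteq> 0" for v
  proof -
    have form: "v \<bullet> (Y *v v) = (homog x \<bullet> v)\<^sup>2 + (norm (affine_part v))\<^sup>2"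
      by (simp add: Y_def matrix_vector_mult_add_rdistrib inner_add_right outer_form D_mult
          inner_commute[of v] inner_direction power2_norm_eq_inner)
    show ?thesis
    proof (cases "affine_part v = 0")
      case False
      then have "0 < (norm (affine_part v))\<^sup>2" by simp
      then show ?thesis
        unfolding form by (simp add: add_nonneg_pos)
    next
      case True
      then have "v $ Inr 1 \<noteq> 0"
        using that by (subst (asm) plus_1_vec_eq_iff) simp
      moreover have "homog x \<bullet> v = v $ Inr 1"
        by (simp add: inner_homog True)
      ultimately show ?thesis
        unfolding form True by simp
    qed
  qed
  moreover have "F p \<bullet> Y = 0" if mem: "p \<in> index_pairs" for p
  proof -
    obtain i j where p: "p = (i, j)" "i < j"
      using mem by (auto simp: index_pairs_def)
    have "F p \<bullet> outer (homog x) = 0"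
      using assms mem
      by (auto simp: p F_def inner_outer F_matrix_spec(2)[symmetric] quad_feasible_def)
    moreover have "F p \<bullet> D = (\<Sum>a\<in>UNIV. F p $ Inl a $ Inl a)"
      by (simp add: D_def sym_block_matrix_def inner_vec_def sum_plus_1 mat_def if_distrib
          if_distribR cong: if_cong)
    moreover have "\<dots> = 0"
      by (simp add: p(1) F_def F_matrix_diagonal_zero[OF less_imp_neq[OF p(2)]])
    ultimately show ?thesis
      by (simp add: Y_def inner_add_right)
  qed
  ultimately have "closed {\<rho>. \<exists>\<nu>. psd (G_matrix xh + (\<Sum>p\<in>index_pairs. \<nu> p *\<^sub>R F p) - \<rho> *\<^sub>R E_matrix)}"
    by (rule dual_values_closed)
  moreover have "(\<exists>\<nu>. psd (G_matrix xh + (\<Sum>p\<in>index_pairs. \<nu> p *\<^sub>R F p) - \<rho> *\<^sub>R E_matrix))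
      \<longleftrightarrow> (\<exists>\<mu>. (\<mu>, \<rho>) \<in> sos_feasible \<Phi> xh)" for \<rho>
  proof
    assume "\<exists>\<nu>. psd (G_matrix xh + (\<Sum>p\<in>index_pairs. \<nu> p *\<^sub>R F p) - \<rho> *\<^sub>R E_matrix)"
    then obtain \<nu> where "psd (G_matrix xh + (\<Sum>p\<in>index_pairs. \<nu> p *\<^sub>R F p) - \<rho> *\<^sub>R E_matrix)" ..
    then show "\<exists>\<mu>. (\<mu>, \<rho>) \<in> sos_feasible \<Phi> xh"
      by (intro exI[of _ "curry \<nu>"]) (simp add: sos_feasible_def F_def split_def)
  next
    assume "\<exists>\<mu>. (\<mu>, \<rho>) \<in> sos_feasible \<Phi> xh"
    then obtain \<mu> where "(\<mu>, \<rho>) \<in> sos_feasible \<Phi> xh" ..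
    then show "\<exists>\<nu>. psd (G_matrix xh + (\<Sum>p\<in>index_pairs. \<nu> p *\<^sub>R F p) - \<rho> *\<^sub>R E_matrix)"
      by (intro exI[of _ "case_prod \<mu>"]) (simp add: sos_feasible_def F_def split_def)
  qed
  ultimately show ?thesis by simp
qed

lemma sos_bound_attained:
  assumes x: "x \<in> quad_feasible \<Phi>" and bound: "ereal (objective xh x) \<le> g_sos \<Phi> xh"
  shows "\<exists>\<mu>. psd (lagrangian_matrix \<Phi> xh \<mu> (objective xh x))"
proof -
  define R where "R = {\<rho>. \<exists>\<mu>. (\<mu>, \<rho>) \<in> sos_feasible \<Phi> xh}"
  have psd: "\<exists>\<mu>. psd (lagrangian_matrix \<Phi> xh \<mu> \<rho>)" if "\<rho> \<in> R" for \<rho>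
    using that by (auto simp: R_def sos_feasible_def lagrangian_matrix_def)
  have le: "\<rho> \<le> objective xh x" if "\<rho> \<in> R" for \<rho>
    using psd[OF that] lagrangian_value[OF x, of xh _ \<rho>] unfolding psd_def
    by (metis diff_ge_0_iff_ge)
  have "objective xh x \<in> closure R"
    unfolding closure_approachable
  proof (intro allI impI)
    fix e :: real assume "e > 0"
    then have "ereal (objective xh x - e) < ereal (objective xh x)" by simp
    also note bound
    finally obtain \<rho> where "\<rho> \<in> R" "objective xh x - e < \<rho>"
      unfolding g_sos_def less_SUP_iff R_def by fastforce
    then show "\<exists>\<rho>\<in>R. dist \<rho> (objective xh x) < e"
      using le by (intro bexI[of _ \<rho>]) (auto simp: dist_real_def)
  qed
  then have "objective xh x \<in> R"
    using sos_values_closed[OF x, of xh] by (simp add: R_def closure_closed)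
  then show ?thesis by (rule psd)
qed

theorem theorem2:
  fixes P :: "'n::{finite,linorder} \<Rightarrow> real^4^3"
    and \<Phi> :: "'n \<Rightarrow> 'n \<Rightarrow> real^3^3"
    and xh xstar :: "real^('n \<times> 2)"
  assumes "CARD('n) \<ge> 2"
    and "\<And>i. rank (P i) = 3"
    and "\<And>i j. i \<noteq> j \<Longrightarrow> camera_center (P i) \<noteq> camera_center (P j)"
    and "\<And>i j. i < j \<Longrightarrow> fundamental_matrix (P i) (P j) (\<Phi> i j)"
    and "quad_optimal \<Phi> xh xstar"
  shows "sdp_exact \<Phi> xh \<longleftrightarrow>
    (\<exists>\<mu> :: 'n \<Rightarrow> 'n \<Rightarrow> real.
        gradient (objective xh) xstar
          + (\<Sum>(i, j)\<in>index_pairs. \<mu> i j *\<^sub>R gradient (epipolar \<Phi> i j) xstar) = 0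
      \<and> psd (mat 1 + (\<Sum>(i, j)\<in>index_pairs. \<mu> i j *\<^sub>R H_matrix \<Phi> i j)))"
proof -
  define \<gamma> where "\<gamma> = objective xh xstar"
  have feas: "xstar \<in> quad_feasible \<Phi>"
    using assms(5) by (simp add: quad_optimal_def)
  have "sdp_exact \<Phi> xh \<longleftrightarrow> ereal \<gamma> \<le> g_sos \<Phi> xh"
    unfolding \<gamma>_def by (rule sdp_exact_iff_sos_bound[OF assms(5)])
  also have "\<dots> \<longleftrightarrow> (\<exists>\<mu>. psd (lagrangian_matrix \<Phi> xh \<mu> \<gamma>))"
  proof
    assume "ereal \<gamma> \<le> g_sos \<Phi> xh"
    then show "\<exists>\<mu>. psd (lagrangian_matrix \<Phi> xh \<mu> \<gamma>)"
      unfolding \<gamma>_def by (rule sos_bound_attained[OF feas])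
  next
    assume "\<exists>\<mu>. psd (lagrangian_matrix \<Phi> xh \<mu> \<gamma>)"
    then obtain \<mu> where "(\<mu>, \<gamma>) \<in> sos_feasible \<Phi> xh"
      by (auto simp: sos_feasible_def lagrangian_matrix_def)
    then show "ereal \<gamma> \<le> g_sos \<Phi> xh"
      unfolding g_sos_def by (rule SUP_upper2) simp
  qed
  also have "\<dots> \<longleftrightarrow> (\<exists>\<mu>. lagrangian_matrix \<Phi> xh \<mu> \<gamma> *v homog xstar = 0
      \<and> psd (upper_left_block (lagrangian_matrix \<Phi> xh \<mu> \<gamma>)))"
  proof (intro ex_cong1 iffI conjI)
    fix \<mu> assume psd: "psd (lagrangian_matrix \<Phi> xh \<mu> \<gamma>)"
    then show "psd (upper_left_block (lagrangian_matrix \<Phi> xh \<mu> \<gamma>))"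
      by (rule psd_upper_left_block)
    show "lagrangian_matrix \<Phi> xh \<mu> \<gamma> *v homog xstar = 0"
      using psd lagrangian_value[OF feas] by (intro psd_form_zero_imp_kernel) (simp_all add: \<gamma>_def)
  next
    fix \<mu> assume "lagrangian_matrix \<Phi> xh \<mu> \<gamma> *v homog xstar = 0
      \<and> psd (upper_left_block (lagrangian_matrix \<Phi> xh \<mu> \<gamma>))"
    then show "psd (lagrangian_matrix \<Phi> xh \<mu> \<gamma>)"
      by (intro psd_from_upper_left_block[OF transpose_lagrangian_matrix]) auto
  qed
  finally show ?thesis
    by (simp only: \<gamma>_def stationary_iff_kernel[OF feas] upper_left_lagrangian)
qed

end
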